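(* Let $\{X_n;f_n^{n+1}\}_{n\in\mathbb{N}}$ be an inverse sequence of countable spaces and let $X_\infty$ be its inverse limit. If $X_n$ has countable fan-tightness for each $n\in\mathbb{N}$, then $X_\infty$ also has countable fan-tightness.
   Context: An inverse sequence $\{X_n;f_n^{n+1}\}_{n\in\mathbb{N}}$ consists of topological spaces $X_n$ and continuous functions $f_n^{n+1}:X_{n+1}\to X_n$. Its inverse limit is the subspace $X_\infty=\{(x_n)_n\in\prod_n X_n:\ x_n=f_n^{n+1}(x_{n+1})\text{ for all }n\in\mathbb{N}\}$ of the product space $\prod_n X_n$. A topological space $X$ has countable fan-tightness if for every $x\in X$ and every sequence $(A_n)_{n\in\mathbb{N}}$ of subsets of $X$ with $x\in\overline{A_n}$ for all $n$, there are finite sets $K_n\subseteq A_n$ ($n\in\mathbb{N}$) such that $x\in\overline{\bigcup_n K_n}$. *)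

theory Defs
  imports "HOL-Analysis.Analysis"
begin

text \<open>
  The spaces are abstract topologies on one common type; arbitrary sequences of spaces are covered,
  since the carriers can be any subsets of that type (for instance of a disjoint union).
  The map \<open>f n\<close> is the bonding map from \<open>X (Suc n)\<close> to \<open>X n\<close>; its values outside the carrier of
  \<open>X (Suc n)\<close> are irrelevant.
\<close>

definition inverse_sequence :: "(nat \<Rightarrow> 'a topology) \<Rightarrow> (nat \<Rightarrow> 'a \<Rightarrow> 'a) \<Rightarrow> bool" where
  "inverse_sequence X f \<longleftrightarrow> (\<forall>n. continuous_map (X (Suc n)) (X n) (f n))"

definition inverse_limit :: "(nat \<Rightarrow> 'a topology) \<Rightarrow> (nat \<Rightarrow> 'a \<Rightarrow> 'a) \<Rightarrow> (nat \<Rightarrow> 'a) topology" where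
  "inverse_limit X f =
     subtopology (product_topology X UNIV)
       {x \<in> topspace (product_topology X UNIV). \<forall>n. x n = f n (x (Suc n))}"

definition countable_fan_tightness :: "'a topology \<Rightarrow> bool" where
  "countable_fan_tightness X \<longleftrightarrow>
     (\<forall>x \<in> topspace X. \<forall>A :: nat \<Rightarrow> 'a set.
        (\<forall>n. A n \<subseteq> topspace X \<and> x \<in> X closure_of A n) \<longrightarrow>
        (\<exists>K :: nat \<Rightarrow> 'a set. (\<forall>n. finite (K n) \<and> K n \<subseteq> A n) \<and> x \<in> X closure_of (\<Union>n. K n)))"

end

theory Submission
  imports Defs
begin

text \<open>
  Every neighbourhood of a point \<open>x\<close> of the inverse limit contains one that is the preimage of an
  open set under a single projection \<open>x \<mapsto> x m\<close> (\<open>inverse_limit_single_coordinate_nhd\<close>): a condition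
  on a coordinate \<open>i \<le> m\<close> is, along threads, an open condition on coordinate \<open>m\<close>, and a basic open
  set of the product restricts finitely many coordinates only.

  So it suffices to satisfy countably many demands, one for each \<open>m\<close>: the set \<open>\<Union>n. K n\<close> has to
  accumulate at \<open>x\<close> in the \<open>m\<close>-th coordinate. Countable fan-tightness of \<open>X m\<close>, applied to the
  projections of the \<^emph>\<open>tail\<close> \<open>A m, A (m + 1), \<dots>\<close>, yields finite subsets of the \<open>A n\<close>, for
  \<open>n \<ge> m\<close>, that meet demand \<open>m\<close>. Because demand \<open>m\<close> leaves the sets \<open>A n\<close> with \<open>n < m\<close> alone, each
  \<open>A n\<close> serves only the finitely many demands \<open>m \<le> n\<close>, and the union of its contributions stays
  finite.
\<close>

lemma topspace_inverse_limit:
  "topspace (inverse_limit X f) = {x. (\<forall>n. x n \<in> topspace (X n)) \<and> (\<forall>n. x n = f n (x (Suc n)))}"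
  by (auto simp: inverse_limit_def PiE_iff)

lemma continuous_map_inverse_limit_projection:
  "continuous_map (inverse_limit X f) (X m) (\<lambda>x. x m)"
  unfolding inverse_limit_def
  by (intro continuous_map_from_subtopology continuous_map_product_projection) simp

text \<open>
  The set \<open>W\<close> below is the preimage of \<open>V\<close> under the composite bonding map from \<open>X (i + k)\<close> to
  \<open>X i\<close>. Describing it by its effect on threads, one bonding map at a time, makes a definition of
  that composite unnecessary.
\<close>

lemma open_condition_on_later_coordinate:
  assumes "inverse_sequence X f" and "openin (X i) V"
  shows "\<exists>W. openin (X (i + k)) W \<and> (\<forall>y \<in> topspace (inverse_limit X f). y (i + k) \<in> W \<longleftrightarrow> y i \<in> V)"
proof (induction k)
  case 0
  show ?case using assms(2) by auto
next
  case (Suc k)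
  then obtain W where W: "openin (X (i + k)) W"
    "\<And>y. y \<in> topspace (inverse_limit X f) \<Longrightarrow> y (i + k) \<in> W \<longleftrightarrow> y i \<in> V"
    by blast
  let ?W' = "{z \<in> topspace (X (Suc (i + k))). f (i + k) z \<in> W}"
  have "openin (X (Suc (i + k))) ?W'"
    using assms(1) W(1) unfolding inverse_sequence_def by (blast intro: openin_continuous_map_preimage)
  moreover have "y (Suc (i + k)) \<in> ?W' \<longleftrightarrow> y i \<in> V" if y: "y \<in> topspace (inverse_limit X f)" for y
  proof -
    have "y (Suc (i + k)) \<in> topspace (X (Suc (i + k)))" "y (i + k) = f (i + k) (y (Suc (i + k)))"
      using y unfolding topspace_inverse_limit by blast+
    then show ?thesis using W(2)[OF y] by simp
  qed
  ultimately show ?case unfolding add_Suc_right by blast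
qed

text \<open>
  A basic neighbourhood in the product imposes open conditions on finitely many coordinates. Moving
  all of them to one index \<open>m\<close> beyond those coordinates turns them into a finite intersection of
  open sets of the single space \<open>X m\<close>.
\<close>

lemma inverse_limit_single_coordinate_nhd:
  assumes seq: "inverse_sequence X f" and U: "openin (inverse_limit X f) U" and "x \<in> U"
  obtains m V where "openin (X m) V" "x m \<in> V"
    "\<And>y. y \<in> topspace (inverse_limit X f) \<Longrightarrow> y m \<in> V \<Longrightarrow> y \<in> U"
proof -
  let ?L = "topspace (inverse_limit X f)"
  have xL: "x \<in> ?L" using openin_subset[OF U] \<open>x \<in> U\<close> by blast
  obtain T where T: "openin (product_topology X UNIV) T" "U = T \<inter> ?L"
    using U unfolding inverse_limit_def openin_subtopology topspace_subtopology by blast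
  have "x \<in> T" using T(2) \<open>x \<in> U\<close> by blast
  then obtain B where B: "finite {i. B i \<noteq> topspace (X i)}" "\<And>i. openin (X i) (B i)"
    "x \<in> Pi\<^sub>E UNIV B" "Pi\<^sub>E UNIV B \<subseteq> T"
    using T(1) unfolding openin_product_topology_alt by auto
  obtain m where m: "\<And>i. B i \<noteq> topspace (X i) \<Longrightarrow> i \<le> m"
    using B(1) unfolding finite_nat_set_iff_bounded_le by blast
  have "\<exists>W. openin (X m) W \<and> (\<forall>y \<in> ?L. y m \<in> W \<longleftrightarrow> y i \<in> B i)" if "i \<le> m" for i
    using open_condition_on_later_coordinate[OF seq B(2), of i "m - i"] that by simp
  then obtain W where W: "\<And>i. i \<le> m \<Longrightarrow> openin (X m) (W i)"
    "\<And>i y. i \<le> m \<Longrightarrow> y \<in> ?L \<Longrightarrow> y m \<in> W i \<longleftrightarrow> y i \<in> B i"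
    by metis
  show thesis
  proof
    show "openin (X m) (\<Inter>i\<in>{..m}. W i)"
      using W(1) by (intro openin_INT2) auto
    show "x m \<in> (\<Inter>i\<in>{..m}. W i)"
      using W(2)[OF _ xL] B(3) by (simp add: PiE_iff)
    show "y \<in> U" if y: "y \<in> ?L" "y m \<in> (\<Inter>i\<in>{..m}. W i)" for y
    proof -
      have "y i \<in> B i" for i
      proof (cases "i \<le> m")
        case True
        then show ?thesis using W(2)[OF True y(1)] y(2) by simp
      next
        case False
        then have "B i = topspace (X i)" using m by blast
        then show ?thesis using y(1) unfolding topspace_inverse_limit by blast
      qed
      then show "y \<in> U" using B(4) T(2) y(1) by (auto simp: PiE_iff)
    qed
  qed
qed

text \<open>
  The form in which the hypothesis on \<open>X m\<close> is used: along a continuous map \<open>p\<close> into a space of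
  countable fan-tightness, the finite sets can be lifted from the images \<open>p ` A n\<close> back to the sets
  \<open>A n\<close> in the domain.
\<close>

lemma countable_fan_tightness_lift:
  assumes Y: "countable_fan_tightness Y" and p: "continuous_map Z Y p"
    and A: "\<And>n::nat. A n \<subseteq> topspace Z" "\<And>n. x \<in> Z closure_of A n"
  shows "\<exists>K. (\<forall>n. finite (K n) \<and> K n \<subseteq> A n) \<and> p x \<in> Y closure_of (p ` (\<Union>n. K n))"
proof -
  have "p x \<in> topspace Y"
    using A(2) p by (metis continuous_map_def Pi_iff in_closure_of)
  moreover have "p ` A n \<subseteq> topspace Y \<and> p x \<in> Y closure_of (p ` A n)" for n
    using A continuous_map_image_subset_topspace[OF p] continuous_map_image_closure_subset[OF p, of "A n"]
    by blast
  ultimately obtain K' where K': "\<And>n. finite (K' n)" "\<And>n. K' n \<subseteq> p ` A n"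
    "p x \<in> Y closure_of (\<Union>n. K' n)"
    using Y[unfolded countable_fan_tightness_def, rule_format, of "p x" "\<lambda>n. p ` A n"] by metis
  have "\<exists>F\<subseteq>A n. finite F \<and> K' n = p ` F" for n
    using finite_subset_image[OF K'(1) K'(2), of n] by blast
  then obtain K where K: "\<And>n. K n \<subseteq> A n" "\<And>n. finite (K n)" "\<And>n. K' n = p ` K n"
    by metis
  have "p ` (\<Union>n. K n) = (\<Union>n. K' n)" using K(3) by (simp add: image_UN)
  then show ?thesis using K(1,2) K'(3) by (intro exI[of _ K]) (simp only: simp_thms)
qed

theorem theorem4p2:
  fixes X :: "nat \<Rightarrow> 'a topology" and f :: "nat \<Rightarrow> 'a \<Rightarrow> 'a"
  assumes "inverse_sequence X f"
    and "\<And>n. countable (topspace (X n))"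
    and "\<And>n. countable_fan_tightness (X n)"
  shows "countable_fan_tightness (inverse_limit X f)"
  unfolding countable_fan_tightness_def
proof (intro ballI allI impI)
  let ?L = "inverse_limit X f"
  fix x and A :: "nat \<Rightarrow> (nat \<Rightarrow> 'a) set"
  assume x: "x \<in> topspace ?L" and A: "\<forall>n. A n \<subseteq> topspace ?L \<and> x \<in> ?L closure_of A n"
  have "\<exists>K. (\<forall>n. finite (K n) \<and> K n \<subseteq> A (m + n)) \<and> x m \<in> X m closure_of ((\<lambda>y. y m) ` (\<Union>n. K n))"
    for m
    using A by (intro countable_fan_tightness_lift[OF assms(3) continuous_map_inverse_limit_projection]) auto
  \<comment> \<open>The second index of \<open>K\<close> counts from the start of the tail: \<open>K m n\<close> lies in \<open>A (m + n)\<close>.\<close>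
  then obtain K where K: "\<And>m n. finite (K m n)" "\<And>m n. K m n \<subseteq> A (m + n)"
    "\<And>m. x m \<in> X m closure_of ((\<lambda>y. y m) ` (\<Union>n. K m n))"
    by metis
  define K' where "K' n = (\<Union>m\<le>n. K m (n - m))" for n
  have K_sub: "K m n \<subseteq> K' (m + n)" for m n
  proof -
    have "K m (m + n - m) \<subseteq> K' (m + n)" unfolding K'_def by (rule UN_upper) simp
    then show ?thesis by simp
  qed
  have K'_sub: "K' n \<subseteq> A n" for n
  proof -
    have "K m (n - m) \<subseteq> A n" if "m \<le> n" for m
      using K(2)[of m "n - m"] that by simp
    then show ?thesis unfolding K'_def by blast
  qed
  have "x \<in> ?L closure_of (\<Union>n. K' n)"
    unfolding in_closure_of
  proof (intro conjI x allI impI)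
    fix U assume "x \<in> U \<and> openin ?L U"
    then obtain m V where V: "openin (X m) V" "x m \<in> V"
      "\<And>y. y \<in> topspace ?L \<Longrightarrow> y m \<in> V \<Longrightarrow> y \<in> U"
      using inverse_limit_single_coordinate_nhd[OF assms(1)] by metis
    obtain y n where y: "y \<in> K m n" "y m \<in> V"
      using K(3)[of m] V(1,2) unfolding in_closure_of by blast
    have "y \<in> U" using V(3) y K(2) A by blast
    then show "\<exists>y. y \<in> (\<Union>n. K' n) \<and> y \<in> U" using y(1) K_sub by blast
  qed
  moreover have "finite (K' n)" for n
    unfolding K'_def using K(1) by simp
  ultimately show "\<exists>K. (\<forall>n. finite (K n) \<and> K n \<subseteq> A n) \<and> x \<in> ?L closure_of (\<Union>n. K n)"
    using K'_sub by blast
qed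

end
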